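(* The monoidal category $\mathbf{CPMet}$ of complete path metric spaces is closed: for objects $(X,d_X)$ and $(Y,d_Y)$ of $\mathbf{CPMet}$ the internal hom exists and is given by $$[X,Y]_{\mathbf{CPMet}}=(\mathbf{CMet}(X,Y),\,d_{\sup,\ell}),$$ where $d_{\sup,\ell}$ is the path metric attached to the supremum metric $d_{\sup}(f,g)=\sup_{x\in X}d_Y(f(x),g(x))$.
   Context: Metric spaces are allowed infinite distances: a metric takes values in $[0,\infty]$. $\mathbf{CMet}$ is the category of complete metric spaces with non-expansive (1-Lipschitz) maps as morphisms. It is symmetric monoidal: the tensor product $(X,d_X)\otimes(Y,d_Y)$ is the Cartesian product $X\times Y$ with the $\ell^1$ metric $d_{X\otimes Y}((x,y),(x',y'))=d_X(x,x')+d_Y(y,y')$, and the unit is the one-point space. The length of a continuous curve $f:[a,b]\to (X,d)$ is $\ell(f)=\sup\sum_i d(f(t_i),f(t_{i+1}))$ over all finite subdivisions $a=t_0\le t_1\le\cdots\le t_n=b$. The path metric attached to $d$ is $d_\ell(x,y)=\inf \ell(f)$ over all continuous curves $f:[a,b]\to X$ with $f(a)=x$, $f(b)=y$ (with $\inf\emptyset=\infty$). $(X,d)$ is a path metric space if $d=d_\ell$. $\mathbf{CPMet}$ is the full subcategory of $\mathbf{CMet}$ consisting of complete path metric spaces, with the monoidal structure inherited from $\mathbf{CMet}$. For $X,Y\in\mathbf{CPMet}$, the internal hom $[X,Y]_{\mathbf{CPMet}}$ is by definition an object representing the functor $\mathbf{CPMet}(-\otimes X,Y):\mathbf{CPMet}^{op}\to\mathbf{Set}$.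 *)

theory Defs
  imports "HOL-Analysis.Analysis"
begin

text \<open>
  The library's metric spaces are real valued, so extended metric spaces with values in
  \<open>[0,\<infinity>]\<close> are set up here, on explicit carriers. The values of \<open>edist\<close> outside the carrier are
  irrelevant.
\<close>

record 'a emspace =
  pts :: "'a set"
  edist :: "'a \<Rightarrow> 'a \<Rightarrow> ennreal"

definition is_emetric :: "'a emspace \<Rightarrow> bool" where
  "is_emetric X \<longleftrightarrow>
     (\<forall>x\<in>pts X. \<forall>y\<in>pts X. edist X x y = 0 \<longleftrightarrow> x = y) \<and>
     (\<forall>x\<in>pts X. \<forall>y\<in>pts X. edist X x y = edist X y x) \<and>
     (\<forall>x\<in>pts X. \<forall>y\<in>pts X. \<forall>z\<in>pts X. edist X x z \<le> edist X x y + edist X y z)"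

definition em_complete :: "'a emspace \<Rightarrow> bool" where
  "em_complete X \<longleftrightarrow>
     (\<forall>\<sigma> :: nat \<Rightarrow> 'a. range \<sigma> \<subseteq> pts X \<longrightarrow>
        (\<forall>e>0. \<exists>N. \<forall>m\<ge>N. \<forall>n\<ge>N. edist X (\<sigma> m) (\<sigma> n) < e) \<longrightarrow>
        (\<exists>x\<in>pts X. (\<lambda>n. edist X (\<sigma> n) x) \<longlonglongrightarrow> 0))"

definition emtopology :: "'a emspace \<Rightarrow> 'a topology" where
  "emtopology X =
     topology (\<lambda>U. U \<subseteq> pts X \<and> (\<forall>x\<in>U. \<exists>r>0. {y \<in> pts X. edist X x y < r} \<subseteq> U))"

lemma openin_emtopology:
  "openin (emtopology X) U \<longleftrightarrow>
     U \<subseteq> pts X \<and> (\<forall>x\<in>U. \<exists>r>0. {y \<in> pts X. edist X x y < r} \<subseteq> U)"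
proof -
  have "istopology (\<lambda>U. U \<subseteq> pts X \<and> (\<forall>x\<in>U. \<exists>r>0. {y \<in> pts X. edist X x y < r} \<subseteq> U))"
    (is "istopology ?P")
    unfolding istopology_def
  proof (intro conjI allI impI)
    fix S T assume S: "?P S" and T: "?P T"
    show "S \<inter> T \<subseteq> pts X" using S by blast
    show "\<forall>x\<in>S \<inter> T. \<exists>r>0. {y \<in> pts X. edist X x y < r} \<subseteq> S \<inter> T"
    proof
      fix x assume "x \<in> S \<inter> T"
      then obtain r s where "r > 0" "{y \<in> pts X. edist X x y < r} \<subseteq> S"
        "s > 0" "{y \<in> pts X. edist X x y < s} \<subseteq> T"
        using S T by blast
      then show "\<exists>r>0. {y \<in> pts X. edist X x y < r} \<subseteq> S \<inter> T"
        by (intro exI[of _ "min r s"]) auto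
    qed
  next
    fix K assume K: "\<forall>S\<in>K. ?P S"
    show "\<Union>K \<subseteq> pts X" using K by blast
    show "\<forall>x\<in>\<Union>K. \<exists>r>0. {y \<in> pts X. edist X x y < r} \<subseteq> \<Union>K" using K by (meson UnionE Union_upper order_trans)
  qed
  then show ?thesis
    by (simp add: emtopology_def topology_inverse')
qed

lemma topspace_emtopology [simp]: "topspace (emtopology X) = pts X"
proof -
  have "openin (emtopology X) (pts X)"
    by (auto simp: openin_emtopology intro: exI[of _ 1])
  then show ?thesis
    by (metis openin_emtopology openin_subset openin_topspace subset_antisym)
qed

definition em_curve :: "'a emspace \<Rightarrow> real \<Rightarrow> real \<Rightarrow> (real \<Rightarrow> 'a) \<Rightarrow> bool" where
  "em_curve X a b f \<longleftrightarrow> a \<le> b \<and> continuous_map (top_of_set {a..b}) (emtopology X) f"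

definition curve_length :: "'a emspace \<Rightarrow> real \<Rightarrow> real \<Rightarrow> (real \<Rightarrow> 'a) \<Rightarrow> ennreal" where
  "curve_length X a b f =
     Sup {\<Sum>i<n. edist X (f (t i)) (f (t (Suc i))) | (n::nat) (t :: nat \<Rightarrow> real).
            t 0 = a \<and> t n = b \<and> (\<forall>i<n. t i \<le> t (Suc i))}"

text \<open>The infimum is taken in \<^typ>\<open>ennreal\<close>, so it is \<open>\<infinity>\<close> when there is no curve.\<close>

definition path_dist :: "'a emspace \<Rightarrow> 'a \<Rightarrow> 'a \<Rightarrow> ennreal" where
  "path_dist X x y =
     Inf {curve_length X a b f | a b f. em_curve X a b f \<and> f a = x \<and> f b = y}"

definition path_space :: "'a emspace \<Rightarrow> 'a emspace" where
  "path_space X = \<lparr>pts = pts X, edist = path_dist X\<rparr>"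

definition cmet :: "'a emspace \<Rightarrow> bool" where
  "cmet X \<longleftrightarrow> is_emetric X \<and> em_complete X"

definition cpmet :: "'a emspace \<Rightarrow> bool" where
  "cpmet X \<longleftrightarrow> cmet X \<and> (\<forall>x\<in>pts X. \<forall>y\<in>pts X. edist X x y = path_dist X x y)"

text \<open>
  Morphisms are extensional functions, so that each non-expansive map is represented exactly
  once. As \<open>CPMet\<close> is a full subcategory, these are its hom-sets as well.
\<close>

definition cmet_hom :: "'a emspace \<Rightarrow> 'b emspace \<Rightarrow> ('a \<Rightarrow> 'b) set" where
  "cmet_hom X Y =
     {f \<in> pts X \<rightarrow>\<^sub>E pts Y. \<forall>x\<in>pts X. \<forall>x'\<in>pts X. edist Y (f x) (f x') \<le> edist X x x'}"

definition em_tensor :: "'a emspace \<Rightarrow> 'b emspace \<Rightarrow> ('a \<times> 'b) emspace" where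
  "em_tensor X Y =
     \<lparr>pts = pts X \<times> pts Y,
      edist = (\<lambda>p q. edist X (fst p) (fst q) + edist Y (snd p) (snd q))\<rparr>"

definition em_unit :: "unit emspace" where
  "em_unit = \<lparr>pts = UNIV, edist = (\<lambda>_ _. 0)\<rparr>"

definition em_id :: "'a emspace \<Rightarrow> 'a \<Rightarrow> 'a" where
  "em_id X = (\<lambda>x\<in>pts X. x)"

text \<open>The morphism \<open>h \<otimes> k\<close> with domain \<open>X \<otimes> Y\<close>.\<close>

definition em_tensor_map ::
  "'a emspace \<Rightarrow> 'b emspace \<Rightarrow> ('a \<Rightarrow> 'c) \<Rightarrow> ('b \<Rightarrow> 'd) \<Rightarrow> 'a \<times> 'b \<Rightarrow> 'c \<times> 'd" where
  "em_tensor_map X Y h k = restrict (map_prod h k) (pts (em_tensor X Y))"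

text \<open>For empty \<open>X\<close> the supremum in \<^typ>\<open>ennreal\<close> is \<open>0\<close>.\<close>

definition sup_space :: "'a emspace \<Rightarrow> 'b emspace \<Rightarrow> ('a \<Rightarrow> 'b) emspace" where
  "sup_space X Y =
     \<lparr>pts = cmet_hom X Y, edist = (\<lambda>f g. SUP x\<in>pts X. edist Y (f x) (g x))\<rparr>"

definition cpmet_ihom :: "'a emspace \<Rightarrow> 'b emspace \<Rightarrow> ('a \<Rightarrow> 'b) emspace" where
  "cpmet_ihom X Y = path_space (sup_space X Y)"

definition em_curry ::
  "'c emspace \<Rightarrow> 'a emspace \<Rightarrow> ('c \<times> 'a \<Rightarrow> 'b) \<Rightarrow> 'c \<Rightarrow> 'a \<Rightarrow> 'b" where
  "em_curry Z X f = (\<lambda>z\<in>pts Z. \<lambda>x\<in>pts X. f (z, x))"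

end

theory Submission
  imports Defs
begin

text \<open>
  Everything rests on a description of the path metric that avoids lengths: \<open>path_dist X x y < c\<close>
  yields a non-expansive map from the real line to \<open>X\<close> which is \<open>x\<close> before time \<open>0\<close> and \<open>y\<close>
  after time \<open>c\<close>, and conversely such a map bounds \<open>path_dist X x y\<close> by \<open>c\<close>
  (\<open>path_dist_less_lip_path\<close>, \<open>path_dist_le_lip_path_between\<close>). The first half is the
  parametrization of a rectifiable curve by its arc length (\<open>arc_length_parametrization\<close>), which
  needs the length function of such a curve to be continuous (\<open>length_increment_small\<close>).

  In this form the path metric is easy to handle. Composing with a non-expansive map shows that
  path metrics are functorial (\<open>path_dist_nonexpansive\<close>). Running paths backwards and one after the
  other gives symmetry and the triangle inequality. A path that is non-expansive for \<open>d\<close> is also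
  non-expansive for its path metric, so that the path metric of a path metric is itself
  (\<open>path_dist_path_space\<close>). Finally, infinitely many paths of summable durations can be run
  one after the other if their endpoints converge (\<open>path_dist_limit_le_suminf\<close>), and so the path
  space of a complete space is complete. Hence \<open>path_space\<close> sends complete metric spaces to complete
  path metric spaces (\<open>cpmet_path_space\<close>).

  The theorem is then formal. Joining \<open>(z, x)\<close> to \<open>(z', x')\<close> through \<open>(z', x)\<close> shows that the tensor
  product of path metric spaces is one. The space of non-expansive maps is complete for the supremum
  metric because uniform Cauchy sequences converge uniformly, so its path space is an object of the
  category. Non-expansive maps on \<open>Z \<otimes> X\<close> correspond to non-expansive maps from \<open>Z\<close> to the space
  with the supremum metric; since the distance of \<open>Z\<close> is its own path metric, functoriality of path
  metrics says that a map out of \<open>Z\<close> is non-expansive for a metric exactly if it is so for the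
  associated path metric.
\<close>

section \<open>Extended metrics\<close>

lemma emetric_self: "is_emetric X \<Longrightarrow> x \<in> pts X \<Longrightarrow> edist X x x = 0"
  by (auto simp: is_emetric_def)

lemma emetric_zeroD: "is_emetric X \<Longrightarrow> x \<in> pts X \<Longrightarrow> y \<in> pts X \<Longrightarrow> edist X x y = 0 \<Longrightarrow> x = y"
  by (auto simp: is_emetric_def)

lemma emetric_sym: "is_emetric X \<Longrightarrow> x \<in> pts X \<Longrightarrow> y \<in> pts X \<Longrightarrow> edist X x y = edist X y x"
  by (auto simp: is_emetric_def)

lemma emetric_triangle:
  "is_emetric X \<Longrightarrow> x \<in> pts X \<Longrightarrow> y \<in> pts X \<Longrightarrow> z \<in> pts X \<Longrightarrow> edist X x z \<le> edist X x y + edist X y z"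
  by (auto simp: is_emetric_def)

text \<open>
  Path distances are bounded through this principle: only a finite real upper bound of \<open>B\<close>
  gives a time at which a path can end.
\<close>

lemma ennreal_le_if_real_bound:
  fixes A B :: ennreal
  assumes "\<And>c. 0 < c \<Longrightarrow> B < ennreal c \<Longrightarrow> A \<le> ennreal c"
  shows "A \<le> B"
proof (rule dense_ge)
  fix x assume "B < x"
  show "A \<le> x"
  proof (cases x)
    case (real r)
    have "0 < ennreal r" using \<open>B < x\<close> real by (metis gr_zeroI not_less_zero)
    then show ?thesis using assms[of r] \<open>B < x\<close> real by simp
  qed simp
qed

lemma openin_emball:
  assumes "is_emetric X" "x \<in> pts X"
  shows "openin (emtopology X) {y \<in> pts X. edist X x y < r}"
  unfolding openin_emtopology
proof (intro conjI ballI)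
  fix y assume y: "y \<in> {y \<in> pts X. edist X x y < r}"
  have "{z \<in> pts X. edist X y z < r - edist X x y} \<subseteq> {y \<in> pts X. edist X x y < r}"
  proof (clarify)
    fix z assume z: "z \<in> pts X" "edist X y z < r - edist X x y"
    have "edist X x z \<le> edist X x y + edist X y z"
      using assms y z by (intro emetric_triangle) auto
    also have "\<dots> < r"
      using z(2) y less_diff_eq_ennreal[of r "edist X x y" "edist X y z"]
      by (metis (no_types, lifting) CollectD add.commute order_less_le_trans top_greatest)
    finally show "edist X x z < r" .
  qed
  moreover have "0 < r - edist X x y" using y by (simp add: diff_gr0_ennreal)
  ultimately show "\<exists>ra>0. {z \<in> pts X. edist X y z < ra} \<subseteq> {y \<in> pts X. edist X x y < r}"
    by blast
qed auto

section \<open>Arc length\<close>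

definition subdivision :: "real \<Rightarrow> real \<Rightarrow> nat \<Rightarrow> (nat \<Rightarrow> real) \<Rightarrow> bool" where
  "subdivision a b n t \<longleftrightarrow> t 0 = a \<and> t n = b \<and> (\<forall>i<n. t i \<le> t (Suc i))"

definition chord_sum :: "'a emspace \<Rightarrow> (real \<Rightarrow> 'a) \<Rightarrow> nat \<Rightarrow> (nat \<Rightarrow> real) \<Rightarrow> ennreal" where
  "chord_sum X f n t = (\<Sum>i<n. edist X (f (t i)) (f (t (Suc i))))"

lemma curve_length_eq:
  "curve_length X a b f = Sup {chord_sum X f n t | n t. subdivision a b n t}"
  by (simp add: curve_length_def subdivision_def chord_sum_def)

lemma chord_sum_le_length: "subdivision a b n t \<Longrightarrow> chord_sum X f n t \<le> curve_length X a b f"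
  unfolding curve_length_eq by (rule Sup_upper) blast

lemma length_leI:
  "(\<And>n t. subdivision a b n t \<Longrightarrow> chord_sum X f n t \<le> L) \<Longrightarrow> curve_length X a b f \<le> L"
  unfolding curve_length_eq by (rule Sup_least) blast

lemma subdivision_mono:
  assumes "subdivision a b n t" "i \<le> j" "j \<le> n"
  shows "t i \<le> t j"
  using assms(2,3)
proof (induction j rule: dec_induct)
  case (step m)
  then show ?case using assms(1) unfolding subdivision_def by (meson Suc_le_lessD less_imp_le order_trans)
qed simp

lemma subdivision_bounds:
  assumes "subdivision a b n t" "i \<le> n"
  shows "a \<le> t i" "t i \<le> b"
  using subdivision_mono[OF assms(1), of 0 i] subdivision_mono[OF assms(1), of i n] assms
  by (auto simp: subdivision_def)

lemma subdivision_single: "a \<le> b \<Longrightarrow> subdivision a b 1 (\<lambda>i. if i = 0 then a else b)"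
  by (simp add: subdivision_def)

lemma chord_le_length: "a \<le> b \<Longrightarrow> edist X (f a) (f b) \<le> curve_length X a b f"
  using chord_sum_le_length[OF subdivision_single, of a b X f] by (simp add: chord_sum_def)

lemma subdivision_min: "subdivision a b n t \<Longrightarrow> a \<le> c \<Longrightarrow> c \<le> b \<Longrightarrow> subdivision a c n (\<lambda>i. min (t i) c)"
  by (auto simp: subdivision_def min_def)

lemma subdivision_max: "subdivision a b n t \<Longrightarrow> a \<le> c \<Longrightarrow> c \<le> b \<Longrightarrow> subdivision c b n (\<lambda>i. max (t i) c)"
  by (auto simp: subdivision_def max_def)

text \<open>
  Cutting a subdivision at \<open>c\<close> by \<open>min\<close> and \<open>max\<close> keeps the index set. The steps on the
  wrong side of \<open>c\<close> degenerate to chords of length \<open>0\<close>, and only a step across \<open>c\<close> needs the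
  triangle inequality.
\<close>

lemma chord_sum_split:
  assumes X: "is_emetric X" and f: "f \<in> {a..b} \<rightarrow> pts X"
    and t: "subdivision a b n t" and c: "a \<le> c" "c \<le> b"
  shows "chord_sum X f n t \<le> chord_sum X f n (\<lambda>i. min (t i) c) + chord_sum X f n (\<lambda>i. max (t i) c)"
  unfolding chord_sum_def sum.distrib[symmetric]
proof (rule sum_mono)
  fix i assume i: "i \<in> {..<n}"
  have le: "t i \<le> t (Suc i)" using i t by (auto simp: subdivision_def)
  have mem: "f c \<in> pts X" "f (t i) \<in> pts X" "f (t (Suc i)) \<in> pts X"
    using f c i subdivision_bounds[OF t, of i] subdivision_bounds[OF t, of "Suc i"] by auto
  consider "t (Suc i) \<le> c" | "c \<le> t i" | "t i \<le> c" "c \<le> t (Suc i)" by linarith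
  then show "edist X (f (t i)) (f (t (Suc i)))
    \<le> edist X (f (min (t i) c)) (f (min (t (Suc i)) c)) + edist X (f (max (t i) c)) (f (max (t (Suc i)) c))"
    by cases (use le mem X in \<open>auto simp: min_absorb1 min_absorb2 max_absorb1 max_absorb2
        emetric_self intro: emetric_triangle\<close>)
qed

lemma Sup_add_Sup_le_ennreal:
  fixes A B :: "ennreal set"
  assumes ne: "A \<noteq> {}" "B \<noteq> {}" and le: "\<And>x y. x \<in> A \<Longrightarrow> y \<in> B \<Longrightarrow> x + y \<le> L"
  shows "Sup A + Sup B \<le> L"
proof -
  have 1: "x + Sup B \<le> L" if "x \<in> A" for x
    using ennreal_SUP_add_right[OF ne(2), of x "\<lambda>y. y"] le[OF that]
    by (metis SUP_least image_ident)
  have "Sup A + Sup B = (SUP x\<in>A. x + Sup B)"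
    using ennreal_SUP_add_left[OF ne(1), of "\<lambda>y. y" "Sup B"] by simp
  also have "\<dots> \<le> L" using 1 by (rule SUP_least)
  finally show ?thesis .
qed

lemma length_superadditive:
  assumes "a \<le> c" "c \<le> b"
  shows "curve_length X a c f + curve_length X c b f \<le> curve_length X a b f"
  unfolding curve_length_eq[of X a c] curve_length_eq[of X c b]
proof (rule Sup_add_Sup_le_ennreal)
  fix x y
  assume "x \<in> {chord_sum X f n t | n t. subdivision a c n t}"
    and "y \<in> {chord_sum X f n t | n t. subdivision c b n t}"
  \<comment> \<open>The two subdivisions are put one after the other.\<close>
  then obtain n t m u where t: "subdivision a c n t" "x = chord_sum X f n t"
    and u: "subdivision c b m u" "y = chord_sum X f m u" by blast
  define v where "v i = (if i \<le> n then t i else u (i - n))" for i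
  have v: "v (n + i) = u i" for i
    using t(1) u(1) by (auto simp: v_def subdivision_def)
  have "subdivision a b (n + m) v"
    unfolding subdivision_def
  proof (intro conjI allI impI)
    show "v 0 = a" using t(1) by (simp add: v_def subdivision_def)
    show "v (n + m) = b" using u(1) by (simp add: v subdivision_def)
    fix i assume i: "i < n + m"
    show "v i \<le> v (Suc i)"
    proof (cases "i < n")
      case True
      then show ?thesis using t(1) by (simp add: v_def subdivision_def)
    next
      case False
      then have "v i = u (i - n)" "v (Suc i) = u (Suc (i - n))"
        using v[of "i - n"] v[of "Suc (i - n)"] by (simp_all add: Suc_diff_le)
      then show ?thesis using u(1) i False by (simp add: subdivision_def)
    qed
  qed
  moreover have "chord_sum X f (n + m) v = x + y"
  proof -
    have "chord_sum X f (n + m) v =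
      (\<Sum>i<n. edist X (f (v i)) (f (v (Suc i)))) + (\<Sum>i<m. edist X (f (v (n + i))) (f (v (n + Suc i))))"
      unfolding chord_sum_def by (induction m) (simp_all add: add.assoc)
    also have "\<dots> = x + y"
      unfolding t(2) u(2) chord_sum_def v by (simp add: v_def)
    finally show ?thesis .
  qed
  ultimately show "x + y \<le> curve_length X a b f"
    using chord_sum_le_length by metis
next
  show "{chord_sum X f n t | n t. subdivision a c n t} \<noteq> {}"
    using subdivision_single[OF assms(1)] by blast
  show "{chord_sum X f n t | n t. subdivision c b n t} \<noteq> {}"
    using subdivision_single[OF assms(2)] by blast
qed

lemma em_curve_mem: "em_curve X a b f \<Longrightarrow> f \<in> {a..b} \<rightarrow> pts X"
  using continuous_map_image_subset_topspace unfolding em_curve_def by fastforce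

lemma em_curve_near:
  assumes X: "is_emetric X" and f: "em_curve X a b f" and s: "s \<in> {a..b}" and e: "0 < e"
  obtains d where "0 < d" "\<And>t. t \<in> {a..b} \<Longrightarrow> \<bar>t - s\<bar> < d \<Longrightarrow> edist X (f s) (f t) < e"
proof -
  have fs: "f s \<in> pts X" using em_curve_mem[OF f] s by auto
  have "openin (top_of_set {a..b}) {t \<in> {a..b}. f t \<in> {y \<in> pts X. edist X (f s) y < e}}"
    using openin_continuous_map_preimage[of "top_of_set {a..b}" "emtopology X" f]
      openin_emball[OF X fs, of e] f unfolding em_curve_def by (metis topspace_euclidean_subtopology)
  then obtain d where "0 < d" and d: "ball s d \<inter> {a..b} \<subseteq> {t \<in> {a..b}. f t \<in> {y \<in> pts X. edist X (f s) y < e}}"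
    using s fs e emetric_self[OF X fs] unfolding openin_contains_ball by force
  show ?thesis
  proof (rule that[OF \<open>0 < d\<close>])
    fix t assume "t \<in> {a..b}" "\<bar>t - s\<bar> < d"
    then have "t \<in> ball s d \<inter> {a..b}" by (auto simp: dist_real_def)
    then show "edist X (f s) (f t) < e" using d by blast
  qed
qed

text \<open>
  Continuity of arc length, on both sides of \<open>s0\<close> at once. Fix a subdivision of \<open>[a, b]\<close> whose
  chord sum is nearly the full length, and cut it at two times \<open>s \<le> t\<close> close to \<open>s0\<close>. The part
  between \<open>s\<close> and \<open>t\<close> has a fixed number of chords, all short by continuity of \<open>f\<close>; hence the lengths
  up to \<open>s\<close> and after \<open>t\<close> nearly exhaust the total, which leaves little for the arc from \<open>s\<close>
  to \<open>t\<close>.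
\<close>

lemma length_increment_small:
  assumes X: "is_emetric X" and f: "em_curve X a b f" and fin: "curve_length X a b f < \<infinity>"
    and s0: "s0 \<in> {a..b}" and e: "0 < e"
  obtains d where "0 < d"
    "\<And>s t. a \<le> s \<Longrightarrow> s \<le> t \<Longrightarrow> t \<le> b \<Longrightarrow> \<bar>s - s0\<bar> < d \<Longrightarrow> \<bar>t - s0\<bar> < d \<Longrightarrow>
       curve_length X a t f \<le> curve_length X a s f + ennreal e"
proof -
  define L where "L = curve_length X a b f"
  have ab: "a \<le> b" using f by (simp add: em_curve_def)
  have mem: "f u \<in> pts X" if "a \<le> u" "u \<le> b" for u using em_curve_mem[OF f] that by auto
  have "\<exists>n p. subdivision a b n p \<and> L \<le> chord_sum X f n p + ennreal (e/2)"
  proof (rule ccontr)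
    assume "\<not> ?thesis"
    then have "\<And>n p. subdivision a b n p \<Longrightarrow> chord_sum X f n p + ennreal (e/2) \<le> L"
      by (meson linear)
    then have "L + Sup {ennreal (e/2)} \<le> L"
      unfolding L_def curve_length_eq
      by (intro Sup_add_Sup_le_ennreal) (use subdivision_single[OF ab] in auto)
    moreover have "L + 0 < L + ennreal (e/2)"
      using fin e by (intro ennreal_add_left_cancel_less[THEN iffD2]) (auto simp: L_def)
    ultimately show False by simp
  qed
  then obtain n p where p: "subdivision a b n p" "L \<le> chord_sum X f n p + ennreal (e/2)" by blast
  \<comment> \<open>The \<open>n\<close> middle chords, each at most \<open>2 * \<eta>\<close>, add up to at most \<open>e/2\<close>;
    the \<open>+ 1\<close> covers \<open>n = 0\<close>.\<close>
  define \<eta> where "\<eta> = e / (4 * (real n + 1))"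
  have \<eta>: "0 < \<eta>" using e by (simp add: \<eta>_def)
  obtain d where d: "0 < d" "\<And>t. t \<in> {a..b} \<Longrightarrow> \<bar>t - s0\<bar> < d \<Longrightarrow> edist X (f s0) (f t) < ennreal \<eta>"
    using em_curve_near[OF X f s0, of "ennreal \<eta>"] \<eta> by auto
  show ?thesis
  proof (rule that[OF d(1)])
    fix s t assume st: "a \<le> s" "s \<le> t" "t \<le> b" "\<bar>s - s0\<bar> < d" "\<bar>t - s0\<bar> < d"
    define q where "q i = max (p i) s" for i
    have q: "subdivision s b n q" unfolding q_def using subdivision_max[OF p(1)] st by simp
    have qm: "subdivision s t n (\<lambda>i. min (q i) t)" using subdivision_min[OF q] st by simp
    have 1: "chord_sum X f n p \<le> chord_sum X f n (\<lambda>i. min (p i) s) + chord_sum X f n q"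
      unfolding q_def using st by (intro chord_sum_split[OF X em_curve_mem[OF f] p(1)]) auto
    have 2: "chord_sum X f n q \<le> chord_sum X f n (\<lambda>i. min (q i) t) + chord_sum X f n (\<lambda>i. max (q i) t)"
      using st em_curve_mem[OF f] by (intro chord_sum_split[OF X _ q]) auto
    have near: "edist X (f u) (f v) \<le> ennreal (2 * \<eta>)" if "s \<le> u" "u \<le> t" "s \<le> v" "v \<le> t" for u v
    proof -
      have uv: "u \<in> {a..b}" "v \<in> {a..b}" "\<bar>u - s0\<bar> < d" "\<bar>v - s0\<bar> < d" using that st by auto
      have "edist X (f u) (f v) \<le> edist X (f u) (f s0) + edist X (f s0) (f v)"
        using uv s0 by (intro emetric_triangle[OF X] mem) auto
      also have "edist X (f u) (f s0) = edist X (f s0) (f u)"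
        using uv s0 by (intro emetric_sym[OF X] mem) auto
      also have "edist X (f s0) (f u) + edist X (f s0) (f v) \<le> ennreal \<eta> + ennreal \<eta>"
        using uv d(2) by (intro add_mono less_imp_le) auto
      also have "\<dots> = ennreal (2 * \<eta>)" using \<eta> by (simp flip: ennreal_plus)
      finally show ?thesis .
    qed
    have "chord_sum X f n (\<lambda>i. min (q i) t) \<le> (\<Sum>i<n. ennreal (2 * \<eta>))"
      unfolding chord_sum_def
      by (intro sum_mono near) (use subdivision_bounds[OF qm] in auto)
    also have "\<dots> = ennreal (real n * (2 * \<eta>))" using \<eta> by (simp add: ennreal_of_nat_eq_real_of_nat ennreal_mult)
    also have "\<dots> \<le> ennreal (e/2)"
      using e by (intro ennreal_leI) (simp add: \<eta>_def field_simps)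
    finally have 3: "chord_sum X f n (\<lambda>i. min (q i) t) \<le> ennreal (e/2)" .
    have 4: "chord_sum X f n (\<lambda>i. min (p i) s) \<le> curve_length X a s f"
      using subdivision_min[OF p(1)] st by (intro chord_sum_le_length) simp
    have 5: "chord_sum X f n (\<lambda>i. max (q i) t) \<le> curve_length X t b f"
      using subdivision_max[OF q] st by (intro chord_sum_le_length) simp
    have half: "ennreal (e/2) + ennreal (e/2) = ennreal e" using e by (simp flip: ennreal_plus)
    have "curve_length X a t f + curve_length X t b f \<le> L"
      unfolding L_def using st by (intro length_superadditive) auto
    also have "L \<le> (curve_length X a s f + (ennreal (e/2) + curve_length X t b f)) + ennreal (e/2)"
      using p(2) 1 2 3 4 5 by (meson add_mono order_refl order_trans)
    also have "\<dots> = (curve_length X a s f + ennreal e) + curve_length X t b f"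
      by (simp add: half[symmetric] ac_simps)
    finally have "curve_length X a t f + curve_length X t b f \<le> (curve_length X a s f + ennreal e) + curve_length X t b f" .
    moreover have "curve_length X t b f < \<infinity>"
      using length_superadditive[of a t b X f] st fin
      by (metis add.commute le_iff_add order_le_less_trans order_trans)
    ultimately show "curve_length X a t f \<le> curve_length X a s f + ennreal e"
      by (auto simp: add.commute[of _ "curve_length X t b f"] ennreal_add_left_cancel_le)
  qed
qed


section \<open>Lipschitz paths and the path metric\<close>

text \<open>
  Paths are parametrized by the whole real line and are constant outside \<open>[0, c]\<close>, so that they
  can be reversed, prolonged and composed without keeping track of their domains.
\<close>

definition lip_path :: "'a emspace \<Rightarrow> (real \<Rightarrow> 'a) \<Rightarrow> bool" where
  "lip_path X g \<longleftrightarrow> (\<forall>s t. g s \<in> pts X \<and> edist X (g s) (g t) \<le> ennreal \<bar>s - t\<bar>)"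

definition lip_path_between :: "'a emspace \<Rightarrow> real \<Rightarrow> 'a \<Rightarrow> 'a \<Rightarrow> (real \<Rightarrow> 'a) \<Rightarrow> bool" where
  "lip_path_between X c x y g \<longleftrightarrow> lip_path X g \<and> (\<forall>s\<le>0. g s = x) \<and> (\<forall>s\<ge>c. g s = y)"

lemma lip_pathD:
  assumes "lip_path X g"
  shows "g s \<in> pts X" "edist X (g s) (g t) \<le> ennreal \<bar>s - t\<bar>"
  using assms by (auto simp: lip_path_def)

lemma lip_pathI:
  assumes X: "is_emetric X" and mem: "\<And>s. g s \<in> pts X"
    and le: "\<And>s t. s \<le> t \<Longrightarrow> edist X (g s) (g t) \<le> ennreal (t - s)"
  shows "lip_path X g"
  unfolding lip_path_def
proof (intro allI conjI mem)
  fix s t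
  show "edist X (g s) (g t) \<le> ennreal \<bar>s - t\<bar>"
    using le[of s t] le[of t s] emetric_sym[OF X mem[of s] mem[of t]]
    by (cases "s \<le> t") auto
qed

lemma lip_path_reverse:
  assumes "lip_path X g"
  shows "lip_path X (\<lambda>s. g (c - s))"
  unfolding lip_path_def
proof (intro allI conjI lip_pathD[OF assms])
  fix s t
  show "edist X (g (c - s)) (g (c - t)) \<le> ennreal \<bar>s - t\<bar>"
    using lip_pathD(2)[OF assms, of "c - s" "c - t"] by (simp add: abs_minus_commute)
qed

lemma lip_path_image:
  assumes "lip_path X g" "h \<in> pts X \<rightarrow> pts Y"
    "\<And>x x'. x \<in> pts X \<Longrightarrow> x' \<in> pts X \<Longrightarrow> edist Y (h x) (h x') \<le> edist X x x'"
  shows "lip_path Y (\<lambda>s. h (g s))"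
  unfolding lip_path_def
proof (intro allI conjI)
  fix s t
  show "h (g s) \<in> pts Y" using assms(2) lip_pathD(1)[OF assms(1)] by blast
  show "edist Y (h (g s)) (h (g t)) \<le> ennreal \<bar>s - t\<bar>"
    by (rule order_trans[OF assms(3) lip_pathD(2)[OF assms(1)]]) (rule lip_pathD(1)[OF assms(1)])+
qed

lemma lip_path_em_curve:
  assumes X: "is_emetric X" and g: "lip_path X g" and "a \<le> b"
  shows "em_curve X a b g"
  unfolding em_curve_def continuous_map_def
proof (intro conjI allI impI assms)
  show "g \<in> topspace (top_of_set {a..b}) \<rightarrow> topspace (emtopology X)" using lip_pathD[OF g] by auto
  fix U assume U: "openin (emtopology X) U"
  have "open {t. g t \<in> U}"
    unfolding open_dist
  proof (intro ballI)
    fix s assume "s \<in> {t. g t \<in> U}"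
    then obtain r where r: "0 < r" "{y \<in> pts X. edist X (g s) y < r} \<subseteq> U"
      using U unfolding openin_emtopology by blast
    obtain e where e: "0 < e" "ennreal e < r"
    proof -
      obtain z where z: "0 < z" "z < r" using dense[OF r(1)] by blast
      then obtain e where "z = ennreal e" by (cases z) auto
      then show thesis using that z by simp
    qed
    have "g t \<in> U" if "dist t s < e" for t
    proof -
      have "edist X (g s) (g t) \<le> ennreal \<bar>s - t\<bar>" by (rule lip_pathD[OF g])
      also have "\<dots> \<le> ennreal e" using that by (intro ennreal_leI) (simp add: dist_real_def)
      finally have "edist X (g s) (g t) < r" using e(2) by simp
      then show ?thesis using r(2) lip_pathD(1)[OF g] by blast
    qed
    then show "\<exists>e>0. \<forall>t. dist t s < e \<longrightarrow> t \<in> {t. g t \<in> U}" using e(1) by blast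
  qed
  then show "openin (top_of_set {a..b}) {x \<in> topspace (top_of_set {a..b}). g x \<in> U}"
    by (auto simp: openin_open Int_def)
qed

lemma length_lip_path_le:
  assumes "lip_path X g"
  shows "curve_length X a b g \<le> ennreal (b - a)"
proof (rule length_leI)
  fix n t assume t: "subdivision a b n t"
  have "chord_sum X g n t \<le> (\<Sum>i<n. ennreal (t (Suc i) - t i))"
    unfolding chord_sum_def
  proof (rule sum_mono)
    fix i assume "i \<in> {..<n}"
    then have "t i \<le> t (Suc i)" using t by (simp add: subdivision_def)
    then show "edist X (g (t i)) (g (t (Suc i))) \<le> ennreal (t (Suc i) - t i)"
      using lip_pathD(2)[OF assms, of "t i" "t (Suc i)"] by simp
  qed
  also have "\<dots> = ennreal (\<Sum>i<n. t (Suc i) - t i)"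
    using t by (intro sum_ennreal) (simp add: subdivision_def)
  also have "\<dots> = ennreal (b - a)"
    using t by (simp add: sum_lessThan_telescope subdivision_def)
  finally show "chord_sum X g n t \<le> ennreal (b - a)" .
qed

text \<open>
  The bound is between any two times, so it also says that a non-expansive path remains
  non-expansive when the metric is replaced by its path metric.
\<close>

lemma path_dist_lip_path_le:
  assumes X: "is_emetric X" and g: "lip_path X g"
  shows "path_dist X (g a) (g b) \<le> ennreal \<bar>a - b\<bar>"
proof -
  have 1: "path_dist X (h a) (h b) \<le> ennreal (b - a)" if "a \<le> b" "lip_path X h" for a b h
  proof -
    have "path_dist X (h a) (h b) \<le> curve_length X a b h"
      unfolding path_dist_def using lip_path_em_curve[OF X that(2,1)] by (intro Inf_lower) blast
    then show ?thesis using length_lip_path_le[OF that(2)] order_trans by blast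
  qed
  show ?thesis
  proof (cases "a \<le> b")
    case True
    then show ?thesis using 1[OF True g] by simp
  next
    case False
    then have "path_dist X (g (0 - (- a))) (g (0 - (- b))) \<le> ennreal (- b - (- a))"
      by (intro 1 lip_path_reverse g) simp
    then show ?thesis using False by simp
  qed
qed

lemma edist_le_path_dist: "edist X x y \<le> path_dist X x y"
  unfolding path_dist_def
proof (rule Inf_greatest, clarify)
  fix a b f assume "em_curve X a b f"
  then show "edist X (f a) (f b) \<le> curve_length X a b f"
    by (intro chord_le_length) (simp add: em_curve_def)
qed

text \<open>
  Let \<open>F t\<close> be the length of \<open>f\<close> on \<open>[a, t]\<close>. By continuity \<open>F\<close> takes every value in \<open>[0, F b]\<close>,
  so a time \<open>\<tau> s\<close> with \<open>F (\<tau> s) = s\<close> can be chosen for \<open>s\<close> in that interval. Since chords are at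
  most as long as arcs, \<open>f \<circ> \<tau>\<close> is non-expansive; for the same reason \<open>f\<close> takes equal values at
  times with equal \<open>F\<close>, which settles the endpoints whatever choice was made.
\<close>

lemma arc_length_parametrization:
  assumes X: "is_emetric X" and f: "em_curve X a b f" and c: "curve_length X a b f < ennreal c"
  obtains g where "lip_path_between X c (f a) (f b) g"
proof -
  have ab: "a \<le> b" using f by (simp add: em_curve_def)
  have mem: "f u \<in> pts X" if "a \<le> u" "u \<le> b" for u using em_curve_mem[OF f] that by auto
  have fin: "curve_length X a b f < \<infinity>" using c by (simp add: order_less_trans[OF _ ennreal_less_top])
  define F where "F t = enn2real (curve_length X a t f)" for t
  have le_top: "curve_length X a t f < top" if "a \<le> t" "t \<le> b" for t
    using length_superadditive[OF that, of X f] fin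
    by (metis add_increasing2 order_le_less_trans infinity_ennreal_def linorder_not_le order_refl zero_le)
  have F: "curve_length X a t f = ennreal (F t)" if "a \<le> t" "t \<le> b" for t
    using le_top[OF that] by (simp add: F_def)
  have F0: "0 \<le> F t" for t by (simp add: F_def)
  have chord: "edist X (f s) (f t) \<le> ennreal (F t - F s) \<and> F s \<le> F t" if "a \<le> s" "s \<le> t" "t \<le> b" for s t
  proof -
    have "ennreal (F s) + edist X (f s) (f t) \<le> ennreal (F t)"
      using length_superadditive[of a s t X f] chord_le_length[of s t X f] that F[of s] F[of t]
      by (metis add_left_mono order_trans)
    moreover have "ennreal (F s) \<le> ennreal (F s) + edist X (f s) (f t)" by simp
    ultimately have "F s \<le> F t" using F0 by (metis ennreal_le_iff order_trans)
    moreover note \<open>ennreal (F s) + edist X (f s) (f t) \<le> ennreal (F t)\<close>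
    ultimately show ?thesis
      by (simp add: ennreal_minus[symmetric] F0 ennreal_le_minus_iff add.commute)
  qed
  have cont: "continuous_on {a..b} F"
    unfolding continuous_on_iff
  proof (intro ballI allI impI)
    fix s0 and e :: real assume s0: "s0 \<in> {a..b}" and e: "0 < e"
    obtain d where d: "0 < d" "\<And>s t. a \<le> s \<Longrightarrow> s \<le> t \<Longrightarrow> t \<le> b \<Longrightarrow> \<bar>s - s0\<bar> < d \<Longrightarrow> \<bar>t - s0\<bar> < d \<Longrightarrow>
       curve_length X a t f \<le> curve_length X a s f + ennreal (e/2)"
      using length_increment_small[OF X f fin s0, of "e/2"] e by auto
    have d': "F t \<le> F s + e/2" if "a \<le> s" "s \<le> t" "t \<le> b" "\<bar>s - s0\<bar> < d" "\<bar>t - s0\<bar> < d" for s t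
      using d(2)[OF that] that F[of s] F[of t] F0 e by (simp flip: ennreal_plus)
    show "\<exists>d>0. \<forall>x'\<in>{a..b}. dist x' s0 < d \<longrightarrow> dist (F x') (F s0) < e"
    proof (intro exI[of _ d] conjI ballI impI d(1))
      fix u assume u: "u \<in> {a..b}" "dist u s0 < d"
      show "dist (F u) (F s0) < e"
      proof (cases "u \<le> s0")
        case True
        then show ?thesis
          using d'[of u s0] chord[of u s0] u s0 e d(1) by (simp add: dist_real_def)
      next
        case False
        then show ?thesis
          using d'[of s0 u] chord[of s0 u] u s0 e d(1) by (simp add: dist_real_def)
      qed
    qed
  qed
  have Fa: "F a = 0"
  proof -
    have "curve_length X a a f \<le> 0"
    proof (rule length_leI)
      fix n t assume t: "subdivision a a n t"
      have "t i = a" if "i \<le> n" for i using subdivision_bounds[OF t that] by simp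
      then show "chord_sum X f n t \<le> 0"
        using emetric_self[OF X mem[of a]] ab by (simp add: chord_sum_def)
    qed
    then show ?thesis by (simp add: F_def)
  qed
  define clip where "clip s = max 0 (min s (F b))" for s
  have "\<exists>t. a \<le> t \<and> t \<le> b \<and> F t = clip s" for s
    by (rule IVT') (use cont ab Fa F0 in \<open>auto simp: clip_def\<close>)
  then obtain \<tau> where \<tau>: "\<And>s. a \<le> \<tau> s" "\<And>s. \<tau> s \<le> b" "\<And>s. F (\<tau> s) = clip s" by metis
  have dist_le: "edist X (f s) (f t) \<le> ennreal \<bar>F t - F s\<bar>" if "a \<le> s" "s \<le> b" "a \<le> t" "t \<le> b" for s t
    using chord[of s t] chord[of t s] that emetric_sym[OF X mem[of s] mem[of t]]
    by (cases "s \<le> t") auto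
  have same: "f s = f t" if "a \<le> s" "s \<le> b" "a \<le> t" "t \<le> b" "F s = F t" for s t
    using dist_le[of s t] that by (intro emetric_zeroD[OF X] mem) auto
  have "lip_path X (\<lambda>s. f (\<tau> s))"
  proof (rule lip_pathI[OF X])
    show "f (\<tau> s) \<in> pts X" for s using \<tau> mem by simp
    fix s t :: real assume "s \<le> t"
    have "edist X (f (\<tau> s)) (f (\<tau> t)) \<le> ennreal \<bar>clip t - clip s\<bar>"
      using dist_le[of "\<tau> s" "\<tau> t"] \<tau> by simp
    also have "\<dots> \<le> ennreal (t - s)"
      using \<open>s \<le> t\<close> F0[of b] by (intro ennreal_leI) (auto simp: clip_def)
    finally show "edist X (f (\<tau> s)) (f (\<tau> t)) \<le> ennreal (t - s)" .
  qed
  moreover have "F b < c" using c F[of b] ab F0 by (simp add: ennreal_less_iff)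
  ultimately have "lip_path_between X c (f a) (f b) (\<lambda>s. f (\<tau> s))"
    unfolding lip_path_between_def
    by (intro conjI allI impI same \<tau>) (use ab \<tau> F0[of b] Fa in \<open>auto simp: clip_def\<close>)
  then show ?thesis by (rule that)
qed

lemma path_dist_less_lip_path:
  assumes "is_emetric X" "path_dist X x y < ennreal c"
  obtains g where "lip_path_between X c x y g"
proof -
  obtain a b f where "em_curve X a b f" "f a = x" "f b = y" "curve_length X a b f < ennreal c"
    using assms(2) unfolding path_dist_def Inf_less_iff by blast
  then show ?thesis using arc_length_parametrization[OF assms(1)] that by blast
qed

lemma path_dist_le_lip_path_between:
  assumes "is_emetric X" "lip_path_between X c x y g" "0 \<le> c"
  shows "path_dist X x y \<le> ennreal c"
  using path_dist_lip_path_le[OF assms(1), of g 0 c] assms(2,3)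
  by (simp add: lip_path_between_def)

text \<open>Functoriality of the path metric: \<open>h\<close> carries non-expansive paths to non-expansive paths.\<close>

lemma path_dist_nonexpansive:
  assumes X: "is_emetric X" and Y: "is_emetric Y" and h: "h \<in> pts X \<rightarrow> pts Y"
    "\<And>x x'. x \<in> pts X \<Longrightarrow> x' \<in> pts X \<Longrightarrow> edist Y (h x) (h x') \<le> edist X x x'"
  shows "path_dist Y (h x) (h x') \<le> path_dist X x x'"
proof (rule ennreal_le_if_real_bound)
  fix c :: real assume c: "0 < c" "path_dist X x x' < ennreal c"
  then obtain g where "lip_path_between X c x x' g" using path_dist_less_lip_path[OF X] by blast
  then have "lip_path_between Y c (h x) (h x') (\<lambda>s. h (g s))"
    using lip_path_image[OF _ h] by (simp add: lip_path_between_def)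
  then show "path_dist Y (h x) (h x') \<le> ennreal c"
    using path_dist_le_lip_path_between[OF Y] c by simp
qed

definition join_at :: "real \<Rightarrow> (real \<Rightarrow> 'a) \<Rightarrow> (real \<Rightarrow> 'a) \<Rightarrow> real \<Rightarrow> 'a" where
  "join_at c g h s = (if s \<le> c then g s else h (s - c))"

lemma lip_path_between_join:
  assumes X: "is_emetric X" and g: "lip_path_between X c x y g" and h: "lip_path_between X d y z h"
    and "0 \<le> c" "0 \<le> d"
  shows "lip_path_between X (c + d) x z (join_at c g h)"
proof -
  have g': "lip_path X g" "\<And>s. s \<le> 0 \<Longrightarrow> g s = x" "\<And>s. c \<le> s \<Longrightarrow> g s = y"
    and h': "lip_path X h" "\<And>s. s \<le> 0 \<Longrightarrow> h s = y" "\<And>s. d \<le> s \<Longrightarrow> h s = z"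
    using g h by (auto simp: lip_path_between_def)
  have "lip_path X (join_at c g h)"
  proof (rule lip_pathI[OF X])
    show "join_at c g h s \<in> pts X" for s
      using lip_pathD[OF g'(1)] lip_pathD[OF h'(1)] by (simp add: join_at_def)
    fix s t :: real assume st: "s \<le> t"
    consider "t \<le> c" | "c < s" | "s \<le> c" "c < t" using st by linarith
    then show "edist X (join_at c g h s) (join_at c g h t) \<le> ennreal (t - s)"
    proof cases
      case 1
      then show ?thesis using lip_pathD(2)[OF g'(1), of s t] st by (simp add: join_at_def)
    next
      case 2
      then show ?thesis using lip_pathD(2)[OF h'(1), of "s - c" "t - c"] st by (simp add: join_at_def)
    next
      case 3
      have "edist X (g s) (h (t - c)) \<le> edist X (g s) (g c) + edist X (h 0) (h (t - c))"
        using g'(3)[of c] h'(2)[of 0] emetric_triangle[OF X lip_pathD(1)[OF g'(1)] lip_pathD(1)[OF g'(1)] lip_pathD(1)[OF h'(1)]]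
        by (metis order_refl)
      also have "\<dots> \<le> ennreal \<bar>s - c\<bar> + ennreal \<bar>0 - (t - c)\<bar>"
        by (intro add_mono lip_pathD(2) g' h')
      also have "\<dots> = ennreal (t - s)" using 3 by (simp flip: ennreal_plus)
      finally show ?thesis using 3 by (simp add: join_at_def)
    qed
  qed
  moreover have "y = z" if "d = 0" using h'(2)[of 0] h'(3)[of 0] that by simp
  ultimately show ?thesis
    using g' h' assms(4,5) by (auto simp: lip_path_between_def join_at_def)
qed

lemma path_dist_refl:
  assumes X: "is_emetric X" and x: "x \<in> pts X"
  shows "path_dist X x x = 0"
  using path_dist_lip_path_le[OF X, of "\<lambda>_. x" 0 0] assms
  by (simp add: lip_path_def emetric_self)

lemma path_dist_sym_le:
  assumes X: "is_emetric X"
  shows "path_dist X y x \<le> path_dist X x y"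
proof (rule ennreal_le_if_real_bound)
  fix c :: real assume c: "0 < c" "path_dist X x y < ennreal c"
  then obtain g where g: "lip_path_between X c x y g" using path_dist_less_lip_path[OF X] by blast
  then have "path_dist X (g c) (g 0) \<le> ennreal \<bar>c - 0\<bar>"
    using path_dist_lip_path_le[OF X] unfolding lip_path_between_def by blast
  then show "path_dist X y x \<le> ennreal c" using g c by (simp add: lip_path_between_def)
qed

lemma path_dist_sym: "is_emetric X \<Longrightarrow> path_dist X y x = path_dist X x y"
  by (simp add: path_dist_sym_le antisym)

lemma path_dist_triangle:
  assumes X: "is_emetric X"
  shows "path_dist X x z \<le> path_dist X x y + path_dist X y z"
proof (rule ennreal_le_if_real_bound)
  fix c :: real assume c: "0 < c" "path_dist X x y + path_dist X y z < ennreal c"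
  obtain p q where p: "path_dist X x y = ennreal p" "0 \<le> p" and q: "path_dist X y z = ennreal q" "0 \<le> q"
    using c(2) by (cases "path_dist X x y"; cases "path_dist X y z") auto
  have "p + q < c" using c p q by (simp flip: ennreal_plus add: ennreal_less_iff)
  \<comment> \<open>Each of the two paths gets half of the slack.\<close>
  define e where "e = (c - p - q) / 2"
  have e: "0 < e" "(p + e) + (q + e) = c" using \<open>p + q < c\<close> by (auto simp: e_def field_simps)
  obtain g h where "lip_path_between X (p + e) x y g" "lip_path_between X (q + e) y z h"
    using path_dist_less_lip_path[OF X, of x y "p + e"] path_dist_less_lip_path[OF X, of y z "q + e"]
      p q e by (metis ennreal_less_iff less_add_same_cancel1)
  from lip_path_between_join[OF X this] p q e
  show "path_dist X x z \<le> ennreal c"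
    using path_dist_le_lip_path_between[OF X] c(1) by (metis add_nonneg_nonneg less_imp_le)
qed


lemma edist_limit_le:
  assumes X: "is_emetric X"
    and mem: "\<And>n. u n \<in> pts X" "\<And>n. v n \<in> pts X" "x \<in> pts X" "y \<in> pts X"
    and lim: "(\<lambda>n::nat. edist X (u n) x) \<longlonglongrightarrow> 0" "(\<lambda>n. edist X (v n) y) \<longlonglongrightarrow> 0"
    and le: "eventually (\<lambda>n. edist X (u n) (v n) \<le> c) sequentially"
  shows "edist X x y \<le> c"
proof -
  have "(\<lambda>n. edist X (u n) x + c + edist X (v n) y) \<longlonglongrightarrow> 0 + c + 0"
    by (intro tendsto_intros lim)
  then have "(\<lambda>n. edist X (u n) x + c + edist X (v n) y) \<longlonglongrightarrow> c" by simp
  moreover have "eventually (\<lambda>n. edist X x y \<le> edist X (u n) x + c + edist X (v n) y) sequentially"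
    using le
  proof eventually_elim
    case (elim n)
    have "edist X x y \<le> edist X x (u n) + edist X (u n) y"
      by (intro emetric_triangle X mem)
    also have "edist X (u n) y \<le> edist X (u n) (v n) + edist X (v n) y"
      by (intro emetric_triangle X mem)
    also have "edist X x (u n) = edist X (u n) x" by (intro emetric_sym X mem)
    finally have "edist X x y \<le> edist X (u n) x + (edist X (u n) (v n) + edist X (v n) y)"
      by (simp add: add_left_mono)
    also have "\<dots> \<le> edist X (u n) x + (c + edist X (v n) y)"
      by (intro add_mono elim order_refl)
    finally show ?case by (simp add: add.assoc)
  qed
  ultimately show ?thesis by (rule tendsto_lowerbound) simp
qed

text \<open>
  Infinite concatenation. \<open>H k\<close> runs through the first \<open>k\<close> paths, reaches \<open>\<tau> k\<close> at time \<open>c k\<close> and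
  stays there. At each time before \<open>suminf e\<close> the sequence \<open>H k s\<close> is eventually constant, and from
  \<open>suminf e\<close> on it equals \<open>\<tau> k\<close>, which tends to \<open>x\<close>. So the \<open>H k\<close> converge pointwise, and the limit
  is again non-expansive.
\<close>

lemma path_dist_limit_le_suminf:
  assumes X: "is_emetric X" and x: "x \<in> pts X"
    and e: "\<And>k. 0 < e k" "summable e"
    and near: "\<And>k. path_dist X (\<tau> k) (\<tau> (Suc k)) < ennreal (e k)"
    and lim: "(\<lambda>k. edist X (\<tau> k) x) \<longlonglongrightarrow> 0"
  shows "path_dist X (\<tau> 0) x \<le> ennreal (suminf e)"
proof -
  have "\<exists>g. lip_path_between X (e k) (\<tau> k) (\<tau> (Suc k)) g" for k
    using path_dist_less_lip_path[OF X near[of k]] by blast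
  then obtain g where g: "\<And>k. lip_path_between X (e k) (\<tau> k) (\<tau> (Suc k)) (g k)" by metis
  define c where "c k = sum e {..<k}" for k
  have c: "c 0 = 0" "c (Suc k) = c k + e k" "0 \<le> c k" "c k < suminf e" for k
    using e by (auto simp: c_def sum_nonneg less_imp_le intro: sum_less_suminf)
  define H where "H = rec_nat (\<lambda>_. \<tau> 0) (\<lambda>k h. join_at (c k) h (g k))"
  have H_Suc: "H (Suc k) = join_at (c k) (H k) (g k)" for k by (simp add: H_def)
  have \<tau>: "\<tau> k \<in> pts X" for k
    using g[of k] lip_pathD(1)[of X "g k" 0] by (simp add: lip_path_between_def)
  have H: "lip_path_between X (c k) (\<tau> 0) (\<tau> k) (H k)" for k
  proof (induction k)
    case 0
    show ?case using \<tau>[of 0] emetric_self[OF X] by (simp add: lip_path_between_def lip_path_def H_def)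
  next
    case (Suc k)
    then show ?case
      unfolding H_Suc c(2) using c(3) e(1) by (intro lip_path_between_join[OF X Suc g]) (auto intro: less_imp_le)
  qed
  have H': "lip_path X (H k)" "s \<le> 0 \<Longrightarrow> H k s = \<tau> 0" "c k \<le> s \<Longrightarrow> H k s = \<tau> k" for k s
    using H[of k] by (auto simp: lip_path_between_def)
  have c_mono: "c k \<le> c m" if "k \<le> m" for k m
    unfolding c_def using that e(1) by (intro sum_mono2) (auto intro: less_imp_le)
  have stable: "H m s = H k s" if "s \<le> c k" "k \<le> m" for s k m
    using that(2)
  proof (induction m rule: dec_induct)
    case (step m)
    then have "s \<le> c m" using c_mono that(1) order_trans by blast
    then show ?case using step.IH by (simp add: H_Suc join_at_def)
  qed simp
  define G where "G s = (if \<exists>k. s \<le> c k then H (SOME k. s \<le> c k) s else x)" for s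
  have G_in: "G s \<in> pts X" for s using H'(1) x lip_pathD(1) by (auto simp: G_def)
  have G_lim: "(\<lambda>k. edist X (H k s) (G s)) \<longlonglongrightarrow> 0" for s
  proof (cases "\<exists>k. s \<le> c k")
    case True
    define k where "k = (SOME k. s \<le> c k)"
    have k: "s \<le> c k" unfolding k_def using True by (rule someI_ex)
    have "eventually (\<lambda>m. edist X (H m s) (G s) = 0) sequentially"
      using eventually_ge_at_top[of k]
    proof eventually_elim
      case (elim m)
      then show ?case
        using stable[OF k elim] True emetric_self[OF X G_in[of s]] by (simp add: G_def k_def)
    qed
    then show ?thesis by (rule tendsto_eventually)
  next
    case False
    then have "H k s = \<tau> k" for k using H'(3)[of k s] by (simp add: not_le less_imp_le)
    then show ?thesis using False lim by (simp add: G_def)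
  qed
  have "lip_path X G"
  proof (rule lip_pathI[OF X G_in])
    fix s t :: real assume "s \<le> t"
    then have "edist X (H k s) (H k t) \<le> ennreal (t - s)" for k
      using lip_pathD(2)[OF H'(1), of k s t] by simp
    then show "edist X (G s) (G t) \<le> ennreal (t - s)"
      by (intro edist_limit_le[OF X lip_pathD(1)[OF H'(1)] lip_pathD(1)[OF H'(1)] G_in G_in G_lim G_lim]) simp
  qed
  moreover have "G s = \<tau> 0" if "s \<le> 0" for s
  proof -
    have "s \<le> c 0" using that c(1) by simp
    then show ?thesis using H'(2)[OF that] by (auto simp: G_def)
  qed
  moreover have "G s = x" if "suminf e \<le> s" for s
    using that c(4) by (auto simp: G_def) (meson leD order_le_less_trans)
  ultimately have "lip_path_between X (suminf e) (\<tau> 0) x G" by (simp add: lip_path_between_def)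
  then show ?thesis
    using path_dist_le_lip_path_between[OF X] suminf_nonneg[OF e(2)] e(1) by (simp add: less_imp_le)
qed

lemma path_space_emetric:
  assumes X: "is_emetric X"
  shows "is_emetric (path_space X)"
proof -
  have "x = y" if "x \<in> pts X" "y \<in> pts X" "path_dist X x y = 0" for x y
    using edist_le_path_dist[of X x y] that emetric_zeroD[OF X] by simp
  then show ?thesis
    unfolding is_emetric_def path_space_def emspace.simps
    by (intro conjI ballI path_dist_triangle[OF X] path_dist_sym[OF X]) (auto simp: path_dist_refl[OF X])
qed

text \<open>
  A Cauchy sequence for the path metric is Cauchy for \<open>edist X\<close> and has a limit \<open>x\<close> there. To see
  that it converges to \<open>x\<close> in the path metric, start at a late term and follow a subsequence whose
  consecutive path distances decrease geometrically; infinite concatenation then bounds the path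
  distance from that term to \<open>x\<close>.
\<close>

lemma path_space_complete:
  fixes X :: "'a emspace"
  assumes X: "cmet X"
  shows "em_complete (path_space X)"
  unfolding em_complete_def path_space_def emspace.simps
proof (intro allI impI)
  fix \<sigma> :: "nat \<Rightarrow> 'a"
  assume mem: "range \<sigma> \<subseteq> pts X"
    and cauchy: "\<forall>e>0. \<exists>N. \<forall>m\<ge>N. \<forall>n\<ge>N. path_dist X (\<sigma> m) (\<sigma> n) < e"
  have em: "is_emetric X" using X by (simp add: cmet_def)
  have "\<forall>e>0. \<exists>N. \<forall>m\<ge>N. \<forall>n\<ge>N. edist X (\<sigma> m) (\<sigma> n) < e"
    using cauchy edist_le_path_dist order_le_less_trans by metis
  then obtain x where x: "x \<in> pts X" "(\<lambda>n. edist X (\<sigma> n) x) \<longlonglongrightarrow> 0"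
    using X mem unfolding cmet_def em_complete_def by blast
  have "(\<lambda>n. path_dist X (\<sigma> n) x) \<longlonglongrightarrow> 0"
  proof (rule order_tendstoI)
    fix a :: ennreal assume "0 < a"
    then obtain z where "0 < z" "z < a" using dense by blast
    then obtain r where r: "0 < r" "ennreal r < a" by (cases z) auto
    \<comment> \<open>The durations add up to \<open>r\<close>.\<close>
    define e where "e k = r/2 * (1/2)^k" for k :: nat
    have e: "0 < e k" for k using r by (simp add: e_def)
    have "(\<lambda>k. (1/2)^k :: real) sums (1 / (1 - 1/2))" by (rule geometric_sums) simp
    then have "e sums (r/2 * (1 / (1 - 1/2)))" unfolding e_def by (rule sums_mult)
    then have e_sums: "summable e" "suminf e = r" by (auto simp: sums_iff)
    have "\<exists>N. \<forall>m\<ge>N. \<forall>n\<ge>N. path_dist X (\<sigma> m) (\<sigma> n) < ennreal (e k)" for k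
      using cauchy e by simp
    then obtain M where M: "\<And>k m n. M k \<le> m \<Longrightarrow> M k \<le> n \<Longrightarrow> path_dist X (\<sigma> m) (\<sigma> n) < ennreal (e k)"
      by metis
    have "path_dist X (\<sigma> n) x < a" if n: "M 0 \<le> n" for n
    proof -
      \<comment> \<open>The subsequence starts at \<open>n\<close> itself, increases strictly, and is past \<open>M k\<close> at step
        \<open>k\<close>; for \<open>k = 0\<close> this is the assumption on \<open>n\<close>.\<close>
      define i where "i k = n + k + sum M {1..k}" for k
      have i_ge: "M k \<le> i k" for k
        using n member_le_sum[of k "{1..k}" M] by (cases "k = 0") (auto simp: i_def)
      have i_Suc: "i k \<le> i (Suc k)" for k by (simp add: i_def)
      have "filterlim i at_top sequentially"
        by (rule filterlim_at_top_mono[OF filterlim_ident]) (simp add: i_def)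
      then have "(\<lambda>k. edist X (\<sigma> (i k)) x) \<longlonglongrightarrow> 0"
        using x(2) filterlim_compose by fast
      moreover have "path_dist X (\<sigma> (i k)) (\<sigma> (i (Suc k))) < ennreal (e k)" for k
        using M i_ge[of k] i_Suc[of k] by simp
      ultimately have "path_dist X (\<sigma> (i 0)) x \<le> ennreal (suminf e)"
        using path_dist_limit_le_suminf[OF em x(1) e e_sums(1), where \<tau> = "\<lambda>k. \<sigma> (i k)"] by blast
      then show ?thesis using e_sums(2) r(2) by (simp add: i_def)
    qed
    then show "eventually (\<lambda>n. path_dist X (\<sigma> n) x < a) sequentially"
      using eventually_sequentially by blast
  qed simp
  then show "\<exists>x\<in>pts X. (\<lambda>n. path_dist X (\<sigma> n) x) \<longlonglongrightarrow> 0" using x(1) by blast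
qed

text \<open>
  One inequality holds because a metric never exceeds its path metric, the other because
  the same non-expansive paths serve both metrics.
\<close>

lemma path_dist_path_space:
  assumes X: "is_emetric X"
  shows "path_dist (path_space X) x y = path_dist X x y"
proof (rule antisym)
  show "path_dist X x y \<le> path_dist (path_space X) x y"
    using edist_le_path_dist[of "path_space X" x y] by (simp add: path_space_def)
  show "path_dist (path_space X) x y \<le> path_dist X x y"
  proof (rule ennreal_le_if_real_bound)
    fix c :: real assume c: "0 < c" "path_dist X x y < ennreal c"
    then obtain g where g: "lip_path_between X c x y g" using path_dist_less_lip_path[OF X] by blast
    then have "lip_path_between (path_space X) c x y g"
      using path_dist_lip_path_le[OF X] by (simp add: lip_path_between_def lip_path_def path_space_def)
    then show "path_dist (path_space X) x y \<le> ennreal c"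
      using path_dist_le_lip_path_between[OF path_space_emetric[OF X]] c(1) by simp
  qed
qed

lemma cpmet_path_space:
  assumes "cmet X"
  shows "cpmet (path_space X)"
proof -
  have "is_emetric X" using assms by (simp add: cmet_def)
  then have "path_dist (path_space X) x y = path_dist X x y" for x y
    by (rule path_dist_path_space)
  then show ?thesis
    using path_space_emetric[of X] path_space_complete[OF assms] \<open>is_emetric X\<close>
    unfolding cpmet_def cmet_def by (simp add: path_space_def)
qed

section \<open>The tensor product\<close>

lemma cpmet_em_unit: "cpmet em_unit"
proof -
  have em: "is_emetric em_unit" by (simp add: is_emetric_def em_unit_def)
  moreover have "em_complete em_unit" by (auto simp: em_complete_def em_unit_def)
  moreover have "path_dist em_unit x y = 0" for x y
    using path_dist_refl[OF em, of x] by (simp add: em_unit_def)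
  ultimately show ?thesis by (simp add: cpmet_def cmet_def) (simp add: em_unit_def)
qed

lemma em_tensor_emetric:
  assumes Z: "is_emetric Z" and X: "is_emetric X"
  shows "is_emetric (em_tensor Z X)"
  unfolding is_emetric_def
proof (intro conjI ballI)
  fix p q assume p: "p \<in> pts (em_tensor Z X)" and q: "q \<in> pts (em_tensor Z X)"
  show "(edist (em_tensor Z X) p q = 0) = (p = q)"
    using p q emetric_zeroD[OF Z] emetric_zeroD[OF X] emetric_self[OF Z] emetric_self[OF X]
    by (auto simp: em_tensor_def)
  show "edist (em_tensor Z X) p q = edist (em_tensor Z X) q p"
    using p q emetric_sym[OF Z, of "fst p" "fst q"] emetric_sym[OF X, of "snd p" "snd q"]
    by (auto simp: em_tensor_def)
  fix r assume r: "r \<in> pts (em_tensor Z X)"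
  show "edist (em_tensor Z X) p r \<le> edist (em_tensor Z X) p q + edist (em_tensor Z X) q r"
    using p q r add_mono[OF emetric_triangle[OF Z, of "fst p" "fst q" "fst r"] emetric_triangle[OF X, of "snd p" "snd q" "snd r"]]
    by (auto simp: em_tensor_def ac_simps)
qed

lemma em_completeD:
  assumes "em_complete X" "\<And>n. \<sigma> n \<in> pts X"
    "\<And>e. 0 < e \<Longrightarrow> \<exists>N. \<forall>m\<ge>N. \<forall>n\<ge>N. edist X (\<sigma> m) (\<sigma> n) < e"
  obtains x where "x \<in> pts X" "(\<lambda>n. edist X (\<sigma> n) x) \<longlonglongrightarrow> 0"
  using assms unfolding em_complete_def by (metis image_subset_iff)

lemma em_tensor_complete:
  fixes Z :: "'a emspace" and X :: "'b emspace"
  assumes Z: "em_complete Z" and X: "em_complete X"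
  shows "em_complete (em_tensor Z X)"
  unfolding em_complete_def
proof (intro allI impI)
  fix \<sigma> :: "nat \<Rightarrow> 'a \<times> 'b"
  assume mem: "range \<sigma> \<subseteq> pts (em_tensor Z X)"
    and cauchy: "\<forall>e>0. \<exists>N. \<forall>m\<ge>N. \<forall>n\<ge>N. edist (em_tensor Z X) (\<sigma> m) (\<sigma> n) < e"
  have le: "edist Z (fst p) (fst q) \<le> edist (em_tensor Z X) p q"
    "edist X (snd p) (snd q) \<le> edist (em_tensor Z X) p q" for p q
    by (simp_all add: em_tensor_def)
  have mem': "fst (\<sigma> n) \<in> pts Z" "snd (\<sigma> n) \<in> pts X" for n
  proof -
    have "\<sigma> n \<in> pts Z \<times> pts X" using mem by (auto simp: em_tensor_def)
    then show "fst (\<sigma> n) \<in> pts Z" "snd (\<sigma> n) \<in> pts X" by (simp_all add: mem_Times_iff)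
  qed
  obtain z where z: "z \<in> pts Z" "(\<lambda>n. edist Z (fst (\<sigma> n)) z) \<longlonglongrightarrow> 0"
    using em_completeD[OF Z, of "\<lambda>n. fst (\<sigma> n)"] mem'(1) cauchy le(1) order_le_less_trans by metis
  obtain x where x: "x \<in> pts X" "(\<lambda>n. edist X (snd (\<sigma> n)) x) \<longlonglongrightarrow> 0"
    using em_completeD[OF X, of "\<lambda>n. snd (\<sigma> n)"] mem'(2) cauchy le(2) order_le_less_trans by metis
  have "(\<lambda>n. edist Z (fst (\<sigma> n)) z + edist X (snd (\<sigma> n)) x) \<longlonglongrightarrow> 0 + 0"
    by (intro tendsto_add z x)
  then show "\<exists>p\<in>pts (em_tensor Z X). (\<lambda>n. edist (em_tensor Z X) (\<sigma> n) p) \<longlonglongrightarrow> 0"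
    using z(1) x(1) by (intro bexI[of _ "(z, x)"]) (auto simp: em_tensor_def)
qed

text \<open>
  Both inclusions \<open>z \<mapsto> (z, x)\<close> and \<open>x \<mapsto> (z', x)\<close> are isometric, so the two legs of the route from
  \<open>(z, x)\<close> through \<open>(z', x)\<close> to \<open>(z', x')\<close> cost the distances of the factors.
\<close>

lemma cpmet_em_tensor:
  assumes Z: "cpmet Z" and X: "cpmet X"
  shows "cpmet (em_tensor Z X)"
proof -
  let ?T = "em_tensor Z X"
  have em: "is_emetric Z" "is_emetric X" using Z X by (auto simp: cpmet_def cmet_def)
  have T: "is_emetric ?T" by (intro em_tensor_emetric em)
  have "path_dist ?T p q \<le> edist ?T p q" if "p \<in> pts ?T" "q \<in> pts ?T" for p q
  proof -
    obtain z x z' x' where pq: "p = (z, x)" "q = (z', x')" by (metis surj_pair)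
    have mem: "z \<in> pts Z" "z' \<in> pts Z" "x \<in> pts X" "x' \<in> pts X"
      using that pq by (auto simp: em_tensor_def)
    have 1: "path_dist ?T (z, x) (z', x) \<le> path_dist Z z z'"
      using mem emetric_self[OF em(2)]
      by (intro path_dist_nonexpansive[OF em(1) T, of "\<lambda>z. (z, x)"]) (auto simp: em_tensor_def)
    have 2: "path_dist ?T (z', x) (z', x') \<le> path_dist X x x'"
      using mem emetric_self[OF em(1)]
      by (intro path_dist_nonexpansive[OF em(2) T, of "\<lambda>x. (z', x)"]) (auto simp: em_tensor_def)
    have "path_dist ?T p q \<le> path_dist Z z z' + path_dist X x x'"
      unfolding pq using path_dist_triangle[OF T] add_mono[OF 1 2] order_trans by blast
    also have "\<dots> = edist ?T p q"
      using Z X mem by (simp add: cpmet_def em_tensor_def pq)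
    finally show ?thesis .
  qed
  then show ?thesis
    using T em_tensor_complete[of Z X] Z X edist_le_path_dist[of ?T]
    unfolding cpmet_def cmet_def by (simp add: antisym)
qed

section \<open>Spaces of non-expansive maps\<close>

lemma cmet_homD:
  assumes "f \<in> cmet_hom X Y"
  shows "x \<in> pts X \<Longrightarrow> f x \<in> pts Y"
    "x \<in> pts X \<Longrightarrow> x' \<in> pts X \<Longrightarrow> edist Y (f x) (f x') \<le> edist X x x'"
    "f \<in> extensional (pts X)"
  using assms by (auto simp: cmet_hom_def PiE_iff)

lemma cmet_hom_eqI:
  assumes "f \<in> cmet_hom X Y" "g \<in> cmet_hom X Y" "\<And>x. x \<in> pts X \<Longrightarrow> f x = g x"
  shows "f = g"
  using assms by (meson cmet_homD(3) extensionalityI)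

lemma edist_sup_space_le_iff:
  "edist (sup_space X Y) f g \<le> c \<longleftrightarrow> (\<forall>x\<in>pts X. edist Y (f x) (g x) \<le> c)"
  by (simp add: sup_space_def SUP_le_iff)

lemma edist_le_edist_sup_space: "x \<in> pts X \<Longrightarrow> edist Y (f x) (g x) \<le> edist (sup_space X Y) f g"
  by (auto simp: sup_space_def intro: SUP_upper)

lemma pts_sup_space [simp]: "pts (sup_space X Y) = cmet_hom X Y"
  by (simp add: sup_space_def)

lemma sup_space_emetric:
  assumes Y: "is_emetric Y"
  shows "is_emetric (sup_space X Y)"
  unfolding is_emetric_def pts_sup_space
proof (intro conjI ballI)
  fix f g assume f: "f \<in> cmet_hom X Y" and g: "g \<in> cmet_hom X Y"
  have "f = g" if "edist (sup_space X Y) f g \<le> 0"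
    using that unfolding edist_sup_space_le_iff
    by (intro cmet_hom_eqI[OF f g] emetric_zeroD[OF Y]) (auto intro: cmet_homD[OF f] cmet_homD[OF g])
  moreover have "edist (sup_space X Y) f f \<le> 0"
    unfolding edist_sup_space_le_iff using emetric_self[OF Y] cmet_homD(1)[OF f] by simp
  ultimately show "(edist (sup_space X Y) f g = 0) = (f = g)" by auto
  show "edist (sup_space X Y) f g = edist (sup_space X Y) g f"
    unfolding sup_space_def emspace.simps
    by (intro SUP_cong refl emetric_sym[OF Y] cmet_homD(1)[OF f] cmet_homD(1)[OF g])
  fix h assume h: "h \<in> cmet_hom X Y"
  show "edist (sup_space X Y) f h \<le> edist (sup_space X Y) f g + edist (sup_space X Y) g h"
    unfolding edist_sup_space_le_iff
  proof
    fix x assume x: "x \<in> pts X"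
    have "edist Y (f x) (h x) \<le> edist Y (f x) (g x) + edist Y (g x) (h x)"
      by (intro emetric_triangle[OF Y] cmet_homD(1)[OF f] cmet_homD(1)[OF g] cmet_homD(1)[OF h] x)
    also have "\<dots> \<le> edist (sup_space X Y) f g + edist (sup_space X Y) g h"
      by (intro add_mono edist_le_edist_sup_space x)
    finally show "edist Y (f x) (h x) \<le> edist (sup_space X Y) f g + edist (sup_space X Y) g h" .
  qed
qed

text \<open>
  The pointwise limit of a Cauchy sequence is non-expansive, and letting \<open>m\<close> tend to infinity in the
  Cauchy condition shows that the convergence is uniform.
\<close>

lemma sup_space_complete:
  fixes X :: "'a emspace" and Y :: "'b emspace"
  assumes Y: "cmet Y"
  shows "em_complete (sup_space X Y)"
  unfolding em_complete_def pts_sup_space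
proof (intro allI impI)
  fix \<sigma> :: "nat \<Rightarrow> 'a \<Rightarrow> 'b"
  assume mem: "range \<sigma> \<subseteq> cmet_hom X Y"
    and cauchy: "\<forall>e>0. \<exists>N. \<forall>m\<ge>N. \<forall>n\<ge>N. edist (sup_space X Y) (\<sigma> m) (\<sigma> n) < e"
  have em: "is_emetric Y" and comp: "em_complete Y" using Y by (auto simp: cmet_def)
  have \<sigma>: "\<sigma> n \<in> cmet_hom X Y" for n using mem by auto
  have "\<exists>y. y \<in> pts Y \<and> (\<lambda>n. edist Y (\<sigma> n x) y) \<longlonglongrightarrow> 0" if x: "x \<in> pts X" for x
    using em_completeD[OF comp, of "\<lambda>n. \<sigma> n x"] cmet_homD(1)[OF \<sigma> x] cauchy
      edist_le_edist_sup_space[OF x] order_le_less_trans by metis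
  then obtain l where l: "\<And>x. x \<in> pts X \<Longrightarrow> l x \<in> pts Y"
    "\<And>x. x \<in> pts X \<Longrightarrow> (\<lambda>n. edist Y (\<sigma> n x) (l x)) \<longlonglongrightarrow> 0"
    by metis
  define L where "L = restrict l (pts X)"
  have L: "L \<in> cmet_hom X Y"
  proof -
    have "edist Y (l x) (l x') \<le> edist X x x'" if x: "x \<in> pts X" "x' \<in> pts X" for x x'
      by (rule edist_limit_le[OF em cmet_homD(1)[OF \<sigma> x(1)] cmet_homD(1)[OF \<sigma> x(2)] l(1)[OF x(1)] l(1)[OF x(2)] l(2)[OF x(1)] l(2)[OF x(2)]])
        (simp add: cmet_homD(2)[OF \<sigma> x])
    then show ?thesis using l(1) by (simp add: cmet_hom_def L_def)
  qed
  have "(\<lambda>n. edist (sup_space X Y) (\<sigma> n) L) \<longlonglongrightarrow> 0"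
  proof (rule order_tendstoI)
    fix a :: ennreal assume "0 < a"
    then obtain e where e: "0 < e" "e < a" using dense by blast
    obtain N where N: "\<And>m n. N \<le> m \<Longrightarrow> N \<le> n \<Longrightarrow> edist (sup_space X Y) (\<sigma> m) (\<sigma> n) < e"
      using cauchy e(1) by blast
    have "edist (sup_space X Y) (\<sigma> n) L \<le> e" if n: "N \<le> n" for n
      unfolding edist_sup_space_le_iff
    proof
      fix x assume x: "x \<in> pts X"
      note \<sigma>x = cmet_homD(1)[OF \<sigma> x]
      have "eventually (\<lambda>m. edist Y (\<sigma> n x) (\<sigma> m x) \<le> e) sequentially"
        using eventually_ge_at_top[of N]
      proof eventually_elim
        case (elim m)
        then show ?case
          using N[OF n elim] edist_le_edist_sup_space[OF x, of Y "\<sigma> n" "\<sigma> m"] by simp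
      qed
      then have "edist Y (\<sigma> n x) (l x) \<le> e"
        by (intro edist_limit_le[OF em \<sigma>x \<sigma>x \<sigma>x l(1)[OF x] _ l(2)[OF x], of "\<lambda>_. n" n])
          (simp_all add: emetric_self[OF em \<sigma>x])
      then show "edist Y (\<sigma> n x) (L x) \<le> e" using x by (simp add: L_def)
    qed
    then show "eventually (\<lambda>n. edist (sup_space X Y) (\<sigma> n) L < a) sequentially"
      using e(2) unfolding eventually_sequentially by (meson order_le_less_trans)
  qed simp
  then show "\<exists>f\<in>cmet_hom X Y. (\<lambda>n. edist (sup_space X Y) (\<sigma> n) f) \<longlonglongrightarrow> 0" using L by blast
qed

lemma cmet_sup_space: "cmet Y \<Longrightarrow> cmet (sup_space X Y)"
  using sup_space_emetric sup_space_complete by (auto simp: cmet_def)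

section \<open>The adjunction\<close>

lemma pts_cpmet_ihom [simp]: "pts (cpmet_ihom X Y) = cmet_hom X Y"
  by (simp add: cpmet_ihom_def path_space_def)

lemma edist_cpmet_ihom: "edist (cpmet_ihom X Y) = path_dist (sup_space X Y)"
  by (simp add: cpmet_ihom_def path_space_def)

text \<open>
  For the supremum metric the curried map is non-expansive at once. To pass to the path metric of
  the target, apply functoriality of path metrics; this is where \<open>Z\<close> must be a path metric space.
\<close>

lemma em_curry_in_hom:
  assumes Z: "cpmet Z" and X: "is_emetric X" and Y: "is_emetric Y"
    and f: "f \<in> cmet_hom (em_tensor Z X) Y"
  shows "em_curry Z X f \<in> cmet_hom Z (cpmet_ihom X Y)"
proof -
  have em: "is_emetric Z" using Z by (simp add: cpmet_def cmet_def)
  have f_in: "f (z, x) \<in> pts Y" if "z \<in> pts Z" "x \<in> pts X" for z x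
    using cmet_homD(1)[OF f] that by (simp add: em_tensor_def)
  have f_le: "edist Y (f (z, x)) (f (z', x')) \<le> edist Z z z' + edist X x x'"
    if "z \<in> pts Z" "z' \<in> pts Z" "x \<in> pts X" "x' \<in> pts X" for z z' x x'
    using cmet_homD(2)[OF f, of "(z, x)" "(z', x')"] that by (simp add: em_tensor_def)
  have slice: "em_curry Z X f z \<in> cmet_hom X Y" if z: "z \<in> pts Z" for z
    using z f_in[OF z] f_le[OF z z] emetric_self[OF em z] by (simp add: cmet_hom_def em_curry_def)
  have sup_le: "edist (sup_space X Y) (em_curry Z X f z) (em_curry Z X f z') \<le> edist Z z z'"
    if "z \<in> pts Z" "z' \<in> pts Z" for z z'
    unfolding edist_sup_space_le_iff
  proof
    fix x assume x: "x \<in> pts X"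
    show "edist Y (em_curry Z X f z x) (em_curry Z X f z' x) \<le> edist Z z z'"
      using f_le[OF that x x] that x emetric_self[OF X x] by (simp add: em_curry_def)
  qed
  have "edist (cpmet_ihom X Y) (em_curry Z X f z) (em_curry Z X f z') \<le> edist Z z z'"
    if "z \<in> pts Z" "z' \<in> pts Z" for z z'
  proof -
    have "path_dist (sup_space X Y) (em_curry Z X f z) (em_curry Z X f z') \<le> path_dist Z z z'"
      using slice sup_le by (intro path_dist_nonexpansive[OF em sup_space_emetric[OF Y]]) auto
    then show ?thesis using Z that by (simp add: edist_cpmet_ihom cpmet_def)
  qed
  then show ?thesis using slice by (simp add: cmet_hom_def[of Z]) (simp add: em_curry_def)
qed

text \<open>
  Uncurrying loses nothing because the path metric dominates the supremum metric; going from
  \<open>(z, x)\<close> to \<open>(z', x')\<close> through \<open>(z', x)\<close> turns the two separate estimates into the \<open>\<ell>\<^sup>1\<close> one.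
\<close>

lemma em_curry_surj:
  assumes Y: "is_emetric Y" and F: "F \<in> cmet_hom Z (cpmet_ihom X Y)"
  shows "\<exists>f\<in>cmet_hom (em_tensor Z X) Y. em_curry Z X f = F"
proof
  let ?f = "\<lambda>p\<in>pts Z \<times> pts X. F (fst p) (snd p)"
  have F_in: "F z \<in> cmet_hom X Y" if "z \<in> pts Z" for z using cmet_homD(1)[OF F that] by simp
  have "edist Y (F z x) (F z' x') \<le> edist Z z z' + edist X x x'"
    if mem: "z \<in> pts Z" "z' \<in> pts Z" "x \<in> pts X" "x' \<in> pts X" for z z' x x'
  proof -
    have "edist Y (F z x) (F z' x') \<le> edist Y (F z x) (F z' x) + edist Y (F z' x) (F z' x')"
      using mem by (intro emetric_triangle[OF Y] cmet_homD(1)[OF F_in])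
    also have "edist Y (F z' x) (F z' x') \<le> edist X x x'"
      using mem by (intro cmet_homD(2)[OF F_in])
    also have "edist Y (F z x) (F z' x) \<le> edist (sup_space X Y) (F z) (F z')"
      using mem by (intro edist_le_edist_sup_space)
    also have "\<dots> \<le> edist (cpmet_ihom X Y) (F z) (F z')"
      by (simp add: edist_cpmet_ihom edist_le_path_dist)
    also have "\<dots> \<le> edist Z z z'" using mem by (intro cmet_homD(2)[OF F])
    finally show ?thesis by (simp add: add_mono)
  qed
  then show "?f \<in> cmet_hom (em_tensor Z X) Y"
    using cmet_homD(1)[OF F_in] by (auto simp: cmet_hom_def em_tensor_def)
  show "em_curry Z X ?f = F"
  proof (rule extensionalityI[of _ "pts Z"])
    show "em_curry Z X ?f \<in> extensional (pts Z)" by (simp add: em_curry_def)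
    show "F \<in> extensional (pts Z)" by (rule cmet_homD(3)[OF F])
    fix z assume z: "z \<in> pts Z"
    show "em_curry Z X ?f z = F z"
      using z cmet_homD(3)[OF F_in[OF z]] by (auto simp: em_curry_def extensional_def)
  qed
qed

lemma em_curry_inj: "inj_on (em_curry Z X) (cmet_hom (em_tensor Z X) Y)"
proof (rule inj_onI)
  fix f g assume f: "f \<in> cmet_hom (em_tensor Z X) Y" and g: "g \<in> cmet_hom (em_tensor Z X) Y"
    and eq: "em_curry Z X f = em_curry Z X g"
  show "f = g"
  proof (rule cmet_hom_eqI[OF f g])
    fix p assume "p \<in> pts (em_tensor Z X)"
    then obtain z x where p: "p = (z, x)" "z \<in> pts Z" "x \<in> pts X" by (auto simp: em_tensor_def)
    then show "f p = g p" using fun_cong[OF fun_cong[OF eq], of z x] by (simp add: em_curry_def)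
  qed
qed

lemma em_curry_bij:
  assumes "cpmet Z" "is_emetric X" "is_emetric Y"
  shows "bij_betw (em_curry Z X) (cmet_hom (em_tensor Z X) Y) (cmet_hom Z (cpmet_ihom X Y))"
  unfolding bij_betw_def
  using em_curry_inj em_curry_in_hom[OF assms] em_curry_surj[OF assms(3)] by (metis (no_types) image_iff subsetI subset_antisym)

text \<open>
  Off \<open>pts Z'\<close> both sides are undefined; on it \<open>h z \<in> pts Z\<close> makes the restrictions agree.
\<close>

lemma em_curry_natural:
  assumes h: "h \<in> cmet_hom Z' Z"
  shows "em_curry Z' X (compose (pts (em_tensor Z' X)) f (em_tensor_map Z' X h (em_id X))) =
    compose (pts Z') (em_curry Z X f) h"
proof (intro ext)
  fix z x
  show "em_curry Z' X (compose (pts (em_tensor Z' X)) f (em_tensor_map Z' X h (em_id X))) z x =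
    compose (pts Z') (em_curry Z X f) h z x"
    using cmet_homD(1)[OF h, of z]
    by (auto simp: em_curry_def compose_def em_tensor_map_def em_id_def em_tensor_def)
qed

theorem corollary3p3:
  fixes X :: "'a emspace" and Y :: "'b emspace"
  assumes "cpmet X" and "cpmet Y"
  shows "cpmet em_unit \<and>
    (\<forall>Z :: 'c emspace. cpmet Z \<longrightarrow> cpmet (em_tensor Z X)) \<and>
    cpmet (cpmet_ihom X Y) \<and>
    (\<forall>Z :: 'c emspace. cpmet Z \<longrightarrow>
       bij_betw (em_curry Z X)
         (cmet_hom (em_tensor Z X) Y) (cmet_hom Z (cpmet_ihom X Y))) \<and>
    (\<forall>(Z :: 'c emspace) (Z' :: 'd emspace). \<forall>h f.
       cpmet Z \<longrightarrow> cpmet Z' \<longrightarrow> h \<in> cmet_hom Z' Z \<longrightarrow> f \<in> cmet_hom (em_tensor Z X) Y \<longrightarrow>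
       em_curry Z' X
         (compose (pts (em_tensor Z' X)) f (em_tensor_map Z' X h (em_id X))) =
       compose (pts Z') (em_curry Z X f) h)"
proof -
  have em: "is_emetric X" "is_emetric Y" and "cmet Y" using assms by (auto simp: cpmet_def cmet_def)
  show ?thesis
  proof (intro conjI allI impI)
    show "cpmet em_unit" by (rule cpmet_em_unit)
    show "cpmet (em_tensor Z X)" if "cpmet Z" for Z :: "'c emspace"
      using that assms(1) by (rule cpmet_em_tensor)
    show "cpmet (cpmet_ihom X Y)"
      unfolding cpmet_ihom_def using \<open>cmet Y\<close> by (intro cpmet_path_space cmet_sup_space)
    show "bij_betw (em_curry Z X) (cmet_hom (em_tensor Z X) Y) (cmet_hom Z (cpmet_ihom X Y))"
      if "cpmet Z" for Z :: "'c emspace"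
      using that em by (rule em_curry_bij)
  qed (rule em_curry_natural)
qed

end
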